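(* Let $X$ be a reflexive Banach space and let $J$ be an M-ideal of $X$. Then $(X,J)$ has the quotient lifting property (QLP).
   Context: A closed subspace $J$ of a Banach space $X$ is an M-ideal if its annihilator $J^\perp$ is an L-summand of $X^*$, i.e. there is a linear projection $P$ of $X^*$ onto $J^\perp$ with $\|x^*\|=\|Px^*\|+\|x^*-Px^*\|$ for all $x^*\in X^*$. For a closed subspace $J$ of a Banach space $X$, with quotient map $\pi:X\to X/J$, the pair $(X,J)$ has the quotient lifting property (QLP) if for every Banach space $Y$ and every bounded linear operator $S:Y\to X/J$ there is a bounded linear operator $T:Y\to X$ with $\pi\circ T=S$ and $\|T\|=\|S\|$. *)

theory Defs
  imports "HOL-Analysis.Analysis"
begin

(* The scalar field: up to isomorphism of normed fields, the instances of this class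
   are exactly the real and the complex numbers. *)
class real_or_complex = real_normed_field +
  assumes real_or_complex:
    "(\<forall>z. \<exists>a. z = a *\<^sub>R 1) \<or>
     (\<exists>i. i * i = - 1 \<and>
        (\<forall>z. \<exists>a b. z = a *\<^sub>R 1 + b *\<^sub>R i \<and> norm z = sqrt (a\<^sup>2 + b\<^sup>2)))"

instance real :: real_or_complex
  by standard simp

instance complex :: real_or_complex
proof
  have "\<exists>a b. z = a *\<^sub>R 1 + b *\<^sub>R \<i> \<and> norm z = sqrt (a\<^sup>2 + b\<^sup>2)" for z :: complex
    by (rule exI[of _ "Re z"], rule exI[of _ "Im z"]) (simp add: complex_eq_iff cmod_def)
  then show "(\<forall>z::complex. \<exists>a. z = a *\<^sub>R 1) \<or> (\<exists>i::complex. i * i = - 1 \<and>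
      (\<forall>z. \<exists>a b. z = a *\<^sub>R 1 + b *\<^sub>R i \<and> norm z = sqrt (a\<^sup>2 + b\<^sup>2)))"
    by (intro disjI2 exI[of _ \<i>]) simp
qed

(* A Banach space over 'k: a real Banach space whose real structure is the restriction
   of the scalar multiplication by 'k. *)
locale banach_space_over = vector_space scl
  for scl :: "'k::real_or_complex \<Rightarrow> 'a::banach \<Rightarrow> 'a" +
  assumes scale_of_real: "scl (of_real r) x = r *\<^sub>R x"
    and norm_scale: "norm (scl c x) = norm c * norm x"

lemma banach_space_over_scaleR: "banach_space_over ((*\<^sub>R) :: real \<Rightarrow> 'a::banach \<Rightarrow> 'a)"
  by unfold_locales (auto simp: scaleR_right_distrib scaleR_left_distrib)

lemma banach_space_over_complex: "banach_space_over ((*) :: complex \<Rightarrow> complex \<Rightarrow> complex)"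
  by unfold_locales (simp_all add: algebra_simps norm_mult scaleR_conv_of_real)

lemma banach_space_over_real_iff:
  fixes scl :: "real \<Rightarrow> 'a::banach \<Rightarrow> 'a"
  shows "banach_space_over scl \<longleftrightarrow> scl = (*\<^sub>R)"
proof
  assume "banach_space_over scl"
  then interpret banach_space_over scl .
  show "scl = (*\<^sub>R)"
    using scale_of_real by (intro ext) simp
qed (simp add: banach_space_over_scaleR)

(* Bounded 'k-linear functionals, as a subset of the type of bounded real-linear maps;
   the norm of that type is the operator norm. *)
definition dual_space :: "('k::real_or_complex \<Rightarrow> 'a::banach \<Rightarrow> 'a) \<Rightarrow> ('a \<Rightarrow>\<^sub>L 'k) set" where
  "dual_space scl = {f :: 'a \<Rightarrow>\<^sub>L 'k. \<forall>c x. f (scl c x) = c * f x}"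

lemma dual_space_real: "dual_space ((*\<^sub>R) :: real \<Rightarrow> 'a::banach \<Rightarrow> 'a) = UNIV"
  by (auto simp: dual_space_def blinfun.scaleR_right)

definition fun_scale :: "'k::real_or_complex \<Rightarrow> ('a::banach \<Rightarrow>\<^sub>L 'k) \<Rightarrow> ('a \<Rightarrow>\<^sub>L 'k)" where
  "fun_scale c f = blinfun_mult_right c o\<^sub>L f"

lemma fun_scale_apply [simp]: "fun_scale c f x = c * f x"
  by (simp add: fun_scale_def)

definition annihilator ::
  "('k::real_or_complex \<Rightarrow> 'a::banach \<Rightarrow> 'a) \<Rightarrow> 'a set \<Rightarrow> ('a \<Rightarrow>\<^sub>L 'k) set" where
  "annihilator scl J = {f \<in> dual_space scl. \<forall>x\<in>J. f x = 0}"

definition bidual_element ::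
  "('k::real_or_complex \<Rightarrow> 'a::banach \<Rightarrow> 'a) \<Rightarrow> (('a \<Rightarrow>\<^sub>L 'k) \<Rightarrow> 'k) \<Rightarrow> bool" where
  "bidual_element scl \<phi> \<longleftrightarrow>
     (\<forall>f\<in>dual_space scl. \<forall>g\<in>dual_space scl. \<phi> (f + g) = \<phi> f + \<phi> g) \<and>
     (\<forall>c. \<forall>f\<in>dual_space scl. \<phi> (fun_scale c f) = c * \<phi> f) \<and>
     (\<exists>K. \<forall>f\<in>dual_space scl. norm (\<phi> f) \<le> K * norm f)"

(* Surjectivity of the canonical map into the bidual. *)
definition reflexive_space :: "('k::real_or_complex \<Rightarrow> 'a::banach \<Rightarrow> 'a) \<Rightarrow> bool" where
  "reflexive_space scl \<longleftrightarrow>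
     (\<forall>\<phi>. bidual_element scl \<phi> \<longrightarrow> (\<exists>x. \<forall>f\<in>dual_space scl. \<phi> f = f x))"

(* N is an L-summand of the dual space: P is a linear projection of the dual onto N. *)
definition L_summand_of_dual ::
  "('k::real_or_complex \<Rightarrow> 'a::banach \<Rightarrow> 'a) \<Rightarrow> ('a \<Rightarrow>\<^sub>L 'k) set \<Rightarrow> bool" where
  "L_summand_of_dual scl N \<longleftrightarrow>
     (\<exists>P :: ('a \<Rightarrow>\<^sub>L 'k) \<Rightarrow> ('a \<Rightarrow>\<^sub>L 'k).
        (\<forall>f\<in>dual_space scl. \<forall>g\<in>dual_space scl. P (f + g) = P f + P g) \<and>
        (\<forall>c. \<forall>f\<in>dual_space scl. P (fun_scale c f) = fun_scale c (P f)) \<and>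
        P ` dual_space scl = N \<and>
        (\<forall>f\<in>N. P f = f) \<and>
        (\<forall>f\<in>dual_space scl. norm f = norm (P f) + norm (f - P f)))"

definition M_ideal :: "('k::real_or_complex \<Rightarrow> 'a::banach \<Rightarrow> 'a) \<Rightarrow> 'a set \<Rightarrow> bool" where
  "M_ideal scl J \<longleftrightarrow>
     module.subspace scl J \<and> closed J \<and> L_summand_of_dual scl (annihilator scl J)"

(* The quotient X/J is represented by the cosets of J. Addition of cosets is the elementwise
   sum (+) of sets. *)
definition quot_map :: "'a::banach set \<Rightarrow> 'a \<Rightarrow> 'a set" where
  "quot_map J x = (+) x ` J"

(* Adding J gives the right value J for c = 0; for other scalars it changes nothing. *)
definition quot_scale ::
  "('k::real_or_complex \<Rightarrow> 'a::banach \<Rightarrow> 'a) \<Rightarrow> 'a set \<Rightarrow> 'k \<Rightarrow> 'a set \<Rightarrow> 'a set" where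
  "quot_scale scl J c A = scl c ` A + J"

definition quot_norm :: "'a::banach set \<Rightarrow> real" where
  "quot_norm A = (INF a\<in>A. norm a)"

lemma quot_norm_quot_map: "quot_norm (quot_map J x) = (INF j\<in>J. norm (x + j))"
  by (simp add: quot_norm_def quot_map_def image_image)

lemma quot_map_add:
  assumes "banach_space_over scl" and "module.subspace scl J"
  shows "quot_map J x + quot_map J y = quot_map J (x + y)"
proof -
  interpret banach_space_over scl by fact
  have J: "subspace J" by fact
  have "(x + a) + (y + b) \<in> (+) (x + y) ` J" if "a \<in> J" "b \<in> J" for a b
    using subspace_add[OF J that] by (intro image_eqI[of _ _ "a + b"]) (auto simp: algebra_simps)
  moreover have "\<exists>a\<in>J. \<exists>b\<in>J. (x + y) + c = (x + a) + (y + b)" if "c \<in> J" for c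
    using that subspace_0[OF J] by (intro bexI[of _ c] bexI[of _ 0]) (auto simp: algebra_simps)
  ultimately show ?thesis
    unfolding quot_map_def set_plus_def by auto
qed

lemma quot_scale_quot_map:
  assumes "banach_space_over scl" and "module.subspace scl J"
  shows "quot_scale scl J c (quot_map J x) = quot_map J (scl c x)"
proof -
  interpret banach_space_over scl by fact
  have J: "subspace J" by fact
  have "scl c (x + a) + b \<in> (+) (scl c x) ` J" if "a \<in> J" "b \<in> J" for a b
    using subspace_add[OF J subspace_scale[OF J that(1), of c] that(2)]
    by (intro image_eqI[of _ _ "scl c a + b"]) (auto simp: algebra_simps)
  moreover have "\<exists>a\<in>J. \<exists>b\<in>J. scl c x + d = scl c (x + a) + b" if "d \<in> J" for d
    using that subspace_0[OF J] by (intro bexI[of _ 0] bexI[of _ d]) (auto simp: algebra_simps)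
  ultimately show ?thesis
    unfolding quot_scale_def quot_map_def set_plus_def by auto
qed

definition bounded_linear_to_quot ::
  "('k::real_or_complex \<Rightarrow> 'b::banach \<Rightarrow> 'b) \<Rightarrow> ('k \<Rightarrow> 'a::banach \<Rightarrow> 'a) \<Rightarrow> 'a set \<Rightarrow>
   ('b \<Rightarrow> 'a set) \<Rightarrow> bool" where
  "bounded_linear_to_quot scaleY scaleX J S \<longleftrightarrow>
     (\<forall>y. S y \<in> range (quot_map J)) \<and>
     (\<forall>y z. S (y + z) = S y + S z) \<and>
     (\<forall>c y. S (scaleY c y) = quot_scale scaleX J c (S y)) \<and>
     (\<exists>K. \<forall>y. quot_norm (S y) \<le> K * norm y)"

(* The operator norm of S, in the form of onorm. *)
definition quot_onorm :: "('b::banach \<Rightarrow> 'a::banach set) \<Rightarrow> real" where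
  "quot_onorm S = (SUP y. quot_norm (S y) / norm y)"

(* The quotient lifting property of (X,J) for all Banach spaces on the type 'b. It holds for
   every Banach space if it holds for every type 'b, so 'b is kept arbitrary in theorems. *)
definition quotient_lifting_property ::
  "('k::real_or_complex \<Rightarrow> 'a::banach \<Rightarrow> 'a) \<Rightarrow> 'a set \<Rightarrow> 'b::banach itself \<Rightarrow> bool" where
  "quotient_lifting_property scaleX J TYPE('b) \<longleftrightarrow>
     (\<forall>(scaleY :: 'k \<Rightarrow> 'b \<Rightarrow> 'b) S.
        banach_space_over scaleY \<and> bounded_linear_to_quot scaleY scaleX J S \<longrightarrow>
        (\<exists>T :: 'b \<Rightarrow>\<^sub>L 'a.
           (\<forall>c y. blinfun_apply T (scaleY c y) = scaleX c (blinfun_apply T y)) \<and>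
           quot_map J \<circ> blinfun_apply T = S \<and>
           norm T = quot_onorm S))"

end

theory Submission
  imports Defs
begin

text \<open>
  In a reflexive space an M-ideal \<open>J\<close> is an M-summand, and a complement of \<open>J\<close> is a lift of the
  quotient. Let \<open>P\<close> be the L-projection of the dual onto the annihilator of \<open>J\<close>. For each \<open>x\<close> the map
  \<open>f \<mapsto> (P f) x\<close> is an element of the bidual, so by reflexivity it is evaluation at a point \<open>Q x\<close>;
  in other words, \<open>P\<close> has a preadjoint \<open>Q\<close>. Since \<open>P\<close> takes values in the annihilator, \<open>Q\<close> vanishes on
  \<open>J\<close>; since \<open>P\<close> fixes the annihilator, every \<open>f\<close> in it has \<open>f (x - Q x) = 0\<close>, so \<open>x - Q x \<in> J\<close>; and
  \<open>\<parallel>Q x\<parallel> \<le> \<parallel>x\<parallel>\<close> since \<open>P\<close> is contractive (lemma \<open>reflexive_M_ideal_projection\<close>).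

  Hence \<open>Q\<close> is constant on each coset and selects an element of it. For \<open>j \<in> J\<close> we have
  \<open>\<parallel>Q x\<parallel> = \<parallel>Q (x + j)\<parallel> \<le> \<parallel>x + j\<parallel>\<close>, so that element has the least norm in the coset, namely the
  quotient norm. Given \<open>S\<close>, apply \<open>Q\<close> to any representative of \<open>S y\<close>: the resulting \<open>T\<close> is linear,
  lifts \<open>S\<close> and satisfies \<open>\<parallel>T y\<parallel> = \<parallel>S y\<parallel>\<close> for every \<open>y\<close>, which is more than equality of the operator
  norms.

  The passage from functionals back to points rests on the Hahn-Banach theorem over the scalar
  field, in one form that covers both uses (lemma \<open>hahn_banach_annihilator\<close>): there is a functional
  of norm at most 1 that annihilates \<open>J\<close> and whose value at \<open>v\<close> has modulus at least the distance of
  \<open>v\<close> to \<open>J\<close>. For \<open>J = {0}\<close> it gives norming functionals; for closed \<open>J\<close> it shows that the annihilator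
  determines \<open>J\<close>. It follows from the theorem for real sublinear functionals, proved by showing that
  minimal sublinear functionals are linear.
\<close>

section \<open>Sublinear functionals and the Hahn-Banach theorem\<close>

definition sublinear :: "('a::real_vector \<Rightarrow> real) \<Rightarrow> bool" where
  "sublinear q \<longleftrightarrow> (\<forall>x y. q (x + y) \<le> q x + q y) \<and> (\<forall>r x. 0 \<le> r \<longrightarrow> q (r *\<^sub>R x) \<le> r * q x)"

lemma sublinear_add: "sublinear q \<Longrightarrow> q (x + y) \<le> q x + q y"
  and sublinear_scaleR_le: "sublinear q \<Longrightarrow> 0 \<le> r \<Longrightarrow> q (r *\<^sub>R x) \<le> r * q x"
  by (auto simp: sublinear_def)

lemma sublinear_zero:
  assumes "sublinear q"
  shows "q 0 = 0"
  using sublinear_add[OF assms, of 0 0] sublinear_scaleR_le[OF assms, of 0 0] by simp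

lemma sublinear_scaleR:
  assumes "sublinear q" and "0 \<le> r"
  shows "q (r *\<^sub>R x) = r * q x"
proof (cases "r = 0")
  case True
  then show ?thesis
    using sublinear_zero[OF assms(1)] by simp
next
  case False
  with assms have r: "0 < r" by simp
  have "q ((1 / r) *\<^sub>R r *\<^sub>R x) \<le> (1 / r) * q (r *\<^sub>R x)"
    using r by (intro sublinear_scaleR_le[OF assms(1)]) simp
  then have "r * q x \<le> q (r *\<^sub>R x)"
    using r by (simp add: field_simps)
  then show ?thesis
    using sublinear_scaleR_le[OF assms, of x] by simp
qed

lemma sublinear_minus: "sublinear q \<Longrightarrow> - q (- x) \<le> q x"
  using sublinear_add[of q x "- x"] sublinear_zero[of q] by simp

text \<open>
  Infima of families that are directed in the sense of \<open>add\<close> and \<open>scale\<close> are the source of all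
  sublinear functionals below: distances to a subspace, the smaller functional of
  \<open>sublinear_odd_below\<close>, and lower bounds of chains.
\<close>
lemma sublinear_INF:
  fixes g :: "'i \<Rightarrow> 'a::real_vector \<Rightarrow> real"
  assumes ne: "I \<noteq> {}"
    and bdd: "\<And>x. bdd_below ((\<lambda>i. g i x) ` I)"
    and add: "\<And>i j x y. i \<in> I \<Longrightarrow> j \<in> I \<Longrightarrow> \<exists>k\<in>I. g k (x + y) \<le> g i x + g j y"
    and scale: "\<And>i r x. i \<in> I \<Longrightarrow> 0 \<le> r \<Longrightarrow> \<exists>k\<in>I. g k (r *\<^sub>R x) \<le> r * g i x"
  shows "sublinear (\<lambda>x. INF i\<in>I. g i x)"
  unfolding sublinear_def
proof (intro conjI allI impI)
  have lower: "(INF i\<in>I. g i x) \<le> g i x" if "i \<in> I" for i x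
    using bdd that by (rule cINF_lower)
  fix x y
  have *: "(INF i\<in>I. g i (x + y)) \<le> g i x + g j y" if "i \<in> I" "j \<in> I" for i j
    using add[OF that, of x y] lower[of _ "x + y"] by force
  have "(INF i\<in>I. g i (x + y)) - g i x \<le> (INF j\<in>I. g j y)" if "i \<in> I" for i
    using *[OF that] by (intro cINF_greatest[OF ne]) (simp add: algebra_simps)
  then have "(INF i\<in>I. g i (x + y)) - (INF j\<in>I. g j y) \<le> (INF i\<in>I. g i x)"
    by (intro cINF_greatest[OF ne]) (simp add: algebra_simps)
  then show "(INF i\<in>I. g i (x + y)) \<le> (INF i\<in>I. g i x) + (INF i\<in>I. g i y)"
    by simp
next
  have lower: "(INF i\<in>I. g i x) \<le> g i x" if "i \<in> I" for i x
    using bdd that by (rule cINF_lower)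
  fix r :: real and x
  assume r: "0 \<le> r"
  have *: "(INF i\<in>I. g i (r *\<^sub>R x)) \<le> r * g i x" if "i \<in> I" for i
    using scale[OF that r, of x] lower[of _ "r *\<^sub>R x"] by force
  show "(INF i\<in>I. g i (r *\<^sub>R x)) \<le> r * (INF i\<in>I. g i x)"
  proof (cases "r = 0")
    case True
    then show ?thesis
      using * ne by auto
  next
    case False
    with r have "0 < r" by simp
    then have "(INF i\<in>I. g i (r *\<^sub>R x)) / r \<le> (INF i\<in>I. g i x)"
      using * by (intro cINF_greatest[OF ne]) (simp add: field_simps)
    then show ?thesis
      using \<open>0 < r\<close> by (simp add: field_simps)
  qed
qed

text \<open>
  The functional \<open>x \<mapsto> inf {q (x + t v) - t q v | t \<ge> 0}\<close> is the largest sublinear one below \<open>q\<close> whose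
  value at \<open>- v\<close> is at most \<open>- q v\<close>. It serves twice: to show that a minimal sublinear functional is
  odd, and to make a linear functional below \<open>q\<close> attain \<open>q v\<close> at \<open>v\<close>.
\<close>
lemma sublinear_odd_below:
  fixes q :: "'a::real_vector \<Rightarrow> real"
  assumes q: "sublinear q"
  obtains q' where "sublinear q'" and "q' \<le> q" and "q' (- v) \<le> - q v"
proof -
  define g where "g t x = q (x + t *\<^sub>R v) - t * q v" for t x
  define q' where "q' = (\<lambda>x. INF t\<in>{0..}. g t x)"
  have bound: "- q (- x) \<le> g t x" if "0 \<le> t" for t x
    using sublinear_add[OF q, of "x + t *\<^sub>R v" "- x"] sublinear_scaleR[OF q that, of v]
    by (simp add: g_def)
  then have bdd: "bdd_below ((\<lambda>t. g t x) ` {0..})" for x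
    by (intro bdd_belowI[of _ "- q (- x)"]) auto
  have lower: "q' x \<le> g t x" if "0 \<le> t" for t x
    unfolding q'_def using bdd that by (intro cINF_lower) auto
  \<comment> \<open>The parameters of two points add up, as the half-line in direction v is a convex cone.\<close>
  have "sublinear q'"
    unfolding q'_def
  proof (rule sublinear_INF[OF _ bdd])
    show "{0::real..} \<noteq> {}"
      by auto
    fix s t :: real and x y
    assume "s \<in> {0::real..}" "t \<in> {0..}"
    moreover have "g (s + t) (x + y) \<le> g s x + g t y"
      using sublinear_add[OF q, of "x + s *\<^sub>R v" "y + t *\<^sub>R v"] by (simp add: g_def algebra_simps)
    ultimately show "\<exists>k\<in>{0..}. g k (x + y) \<le> g s x + g t y"
      by (intro bexI[of _ "s + t"]) auto
  next
    fix t r :: real and x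
    assume "t \<in> {0::real..}" "0 \<le> r"
    moreover from this have "g (r * t) (r *\<^sub>R x) = r * g t x"
      using sublinear_scaleR[OF q, of r "x + t *\<^sub>R v"] by (simp add: g_def algebra_simps)
    ultimately show "\<exists>k\<in>{0..}. g k (r *\<^sub>R x) \<le> r * g t x"
      by (intro bexI[of _ "r * t"]) auto
  qed
  moreover have "q' \<le> q"
    using lower[of 0] by (simp add: le_fun_def g_def)
  moreover have "q' (- v) \<le> - q v"
    using lower[of 1 "- v"] sublinear_zero[OF q] by (simp add: g_def)
  ultimately show thesis
    by (rule that)
qed

text \<open>
  Zorn's lemma applies because all sublinear \<open>q \<le> p\<close> share the lower bound \<open>- p (- x)\<close>, so that the
  pointwise infimum of a chain of them exists.
\<close>
lemma minimal_sublinear_below: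
  fixes p :: "'a::real_vector \<Rightarrow> real"
  assumes p: "sublinear p"
  obtains m where "sublinear m" and "m \<le> p" and "\<And>q. sublinear q \<Longrightarrow> q \<le> m \<Longrightarrow> q = m"
proof -
  let ?A = "{q. sublinear q \<and> q \<le> p}"
  let ?R = "relation_of (\<lambda>q q' :: 'a \<Rightarrow> real. q' \<le> q) ?A"
  have "\<exists>m\<in>?A. \<forall>q\<in>?A. q \<le> m \<longrightarrow> q = m"
  proof (rule predicate_Zorn)
    show "partial_order_on ?A ?R"
      by (rule partial_order_on_relation_ofI) auto
    fix C
    assume "C \<in> Chains ?R"
    then have C: "C \<subseteq> ?A" and total: "\<And>q q'. q \<in> C \<Longrightarrow> q' \<in> C \<Longrightarrow> q \<le> q' \<or> q' \<le> q"
      by (auto simp: Chains_def relation_of_def)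
    show "\<exists>u\<in>?A. \<forall>q\<in>C. u \<le> q"
    proof (cases "C = {}")
      case True
      then show ?thesis
        using p by auto
    next
      case False
      have "- p (- x) \<le> q x" if "q \<in> C" for q x
      proof -
        have "q (- x) \<le> p (- x)" and "sublinear q"
          using C that by (auto simp: le_fun_def)
        then show ?thesis
          using sublinear_minus[of q x] by linarith
      qed
      then have bdd: "bdd_below ((\<lambda>q. q x) ` C)" for x
        by (intro bdd_belowI[of _ "- p (- x)"]) auto
      let ?u = "\<lambda>x. INF q\<in>C. q x"
      have "sublinear ?u"
      proof (rule sublinear_INF[OF False bdd])
        fix q q' x y
        assume qq: "q \<in> C" "q' \<in> C"
        then have sub: "q (x + y) \<le> q x + q y" "q' (x + y) \<le> q' x + q' y"
          using C by (auto intro: sublinear_add)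
        \<comment> \<open>The smaller of two members of a chain serves for both.\<close>
        from total[OF qq] show "\<exists>k\<in>C. k (x + y) \<le> q x + q' y"
        proof
          assume "q \<le> q'"
          then have "q y \<le> q' y" by (simp add: le_fun_def)
          with sub qq show ?thesis by (intro bexI[of _ q]) auto
        next
          assume "q' \<le> q"
          then have "q' x \<le> q x" by (simp add: le_fun_def)
          with sub qq show ?thesis by (intro bexI[of _ q']) auto
        qed
      next
        fix q r x
        assume "q \<in> C" "0 \<le> (r::real)"
        then show "\<exists>k\<in>C. k (r *\<^sub>R x) \<le> r * q x"
          using C by (intro bexI[of _ q] sublinear_scaleR_le) auto
      qed
      moreover have le: "?u \<le> q" if "q \<in> C" for q
        using bdd that by (auto simp: le_fun_def intro!: cINF_lower)
      moreover have "?u \<le> p"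
        using False C le by (metis (no_types, lifting) all_not_in_conv mem_Collect_eq order_trans subset_iff)
      ultimately show ?thesis
        by blast
    qed
  qed
  then obtain m where "m \<in> ?A" and "\<And>q. q \<in> ?A \<Longrightarrow> q \<le> m \<Longrightarrow> q = m"
    by blast
  then show thesis
    by (intro that[of m]) (auto intro: order_trans)
qed

text \<open>
  Lowering \<open>m\<close> in the direction \<open>v\<close> with \<open>sublinear_odd_below\<close> cannot change it, so \<open>m\<close> is odd; an odd
  sublinear functional is also superadditive, hence additive.
\<close>
lemma minimal_sublinear_linear:
  fixes m :: "'a::real_vector \<Rightarrow> real"
  assumes m: "sublinear m" and min: "\<And>q. sublinear q \<Longrightarrow> q \<le> m \<Longrightarrow> q = m"
  shows "linear m"
proof -
  have odd: "m (- v) = - m v" for v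
  proof -
    obtain q where "sublinear q" "q \<le> m" "q (- v) \<le> - m v"
      using sublinear_odd_below[OF m] .
    with min[of q] show ?thesis
      using sublinear_minus[OF m, of v] by simp
  qed
  show ?thesis
  proof (rule linearI)
    fix x y
    show "m (x + y) = m x + m y"
      using sublinear_add[OF m, of x y] sublinear_add[OF m, of "- x" "- y"] odd[of "x + y"]
      by (simp add: odd)
  next
    fix r x
    show "m (r *\<^sub>R x) = r *\<^sub>R m x"
      using sublinear_scaleR[OF m, of r x] sublinear_scaleR[OF m, of "- r" x] odd[of "r *\<^sub>R x"]
      by (cases "0 \<le> r") auto
  qed
qed

text \<open>
  Any minimal functional below \<open>p\<close> is linear; to control its value at \<open>v\<close>, first replace \<open>p\<close> by a
  sublinear functional that forces \<open>u (- v) \<le> - p v\<close>.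
\<close>
lemma hahn_banach_sublinear:
  fixes p :: "'a::real_vector \<Rightarrow> real"
  assumes p: "sublinear p"
  obtains u where "linear u" and "u \<le> p" and "u v = p v"
proof -
  obtain q where q: "sublinear q" "q \<le> p" "q (- v) \<le> - p v"
    using sublinear_odd_below[OF p] .
  obtain u where u: "sublinear u" "u \<le> q" and min: "\<And>q. sublinear q \<Longrightarrow> q \<le> u \<Longrightarrow> q = u"
    using minimal_sublinear_below[OF q(1)] by metis
  have lin: "linear u"
    using u(1) min by (rule minimal_sublinear_linear)
  have "u \<le> p"
    using u(2) q(2) by simp
  moreover have "u (- v) \<le> - p v"
    using u(2) q(3) by (auto simp: le_fun_def intro: order_trans)
  then have "p v \<le> u v"
    using linear_neg[OF lin, of v] by simp
  ultimately show thesis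
    by (intro that[OF lin]) (auto simp: le_fun_def intro: antisym)
qed

lemma sublinear_infdist:
  fixes J :: "'a::real_normed_vector set"
  assumes J: "subspace J"
  shows "sublinear (\<lambda>x. infdist x J)"
proof -
  have ne: "J \<noteq> {}"
    using subspace_0[OF J] by auto
  have "sublinear (\<lambda>x. INF j\<in>J. dist x j)"
  proof (rule sublinear_INF[OF ne])
    show "bdd_below ((\<lambda>j. dist x j) ` J)" for x
      by (rule bdd_belowI[of _ 0]) auto
    show "\<exists>k\<in>J. dist (x + y) k \<le> dist x i + dist y j" if "i \<in> J" "j \<in> J" for i j x y
      using that subspace_add[OF J] by (intro bexI[of _ "i + j"] dist_triangle_add) auto
    show "\<exists>k\<in>J. dist (r *\<^sub>R x) k \<le> r * dist x j" if "j \<in> J" "0 \<le> r" for j r x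
    proof (rule bexI)
      have "dist (r *\<^sub>R x) (r *\<^sub>R j) = r * dist x j"
        using that(2) by (simp add: dist_norm flip: scaleR_diff_right)
      then show "dist (r *\<^sub>R x) (r *\<^sub>R j) \<le> r * dist x j"
        by simp
    qed (use that subspace_scale[OF J] in auto)
  qed
  then show ?thesis
    using ne by (simp add: infdist_notempty)
qed

section \<open>Functionals over the scalar field\<close>

text \<open>
  If the real coordinates of a scalar were not unique, \<open>i\<close> would be a real multiple of 1 and its
  square could not be \<open>- 1\<close>. This makes the real part of a scalar well defined.
\<close>
lemma imaginary_unit_unique_coordinates:
  fixes i :: "'k::real_normed_field"
  assumes i: "i * i = - 1" and eq: "of_real a + of_real b * i = of_real a' + of_real b' * i"
  shows "a = a'"
proof -
  have "of_real (b' - b) * i = of_real (a - a')"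
    using eq by (simp add: algebra_simps)
  then have "(of_real (b' - b) * i) * (of_real (b' - b) * i) = of_real (a - a') * (of_real (a - a') :: 'k)"
    by simp
  then have "of_real (b' - b) * of_real (b' - b) * (i * i) = of_real (a - a') * (of_real (a - a') :: 'k)"
    by (simp add: algebra_simps)
  then have "(of_real (- ((b' - b) * (b' - b))) :: 'k) = of_real ((a - a') * (a - a'))"
    unfolding i by simp
  then have "- ((b' - b) * (b' - b)) = (a - a') * (a - a')"
    by (simp only: of_real_eq_iff)
  then have "(a - a')\<^sup>2 + (b' - b)\<^sup>2 = 0"
    unfolding power2_eq_square by linarith
  then show ?thesis
    by (simp add: sum_power2_eq_zero_iff)
qed

context banach_space_over
begin

lemma subspace_imp_real_subspace:
  assumes "subspace J"
  shows "Real_Vector_Spaces.subspace J"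
  using subspace_0[OF assms] subspace_add[OF assms] subspace_scale[OF assms, of _ "of_real _"]
  by (auto simp: Real_Vector_Spaces.subspace_def scale_of_real)

lemma dual_functionalI:
  fixes f :: "'a \<Rightarrow> 'k"
  assumes add: "\<And>x y. f (x + y) = f x + f y"
    and scale: "\<And>c x. f (scl c x) = c * f x"
    and bound: "\<And>x. norm (f x) \<le> norm x"
  obtains F where "F \<in> dual_space scl" and "norm F \<le> 1" and "blinfun_apply F = f"
proof -
  have bl: "bounded_linear f"
  proof (rule bounded_linear_intro[where K = 1])
    show "f (r *\<^sub>R x) = r *\<^sub>R f x" for r x
      using scale[of "of_real r" x] by (simp add: scale_of_real scaleR_conv_of_real)
  qed (use add bound in auto)
  have "Blinfun f \<in> dual_space scl"
    by (simp add: dual_space_def bounded_linear_Blinfun_apply[OF bl] scale)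
  moreover have "norm (Blinfun f) \<le> 1"
    by (rule norm_blinfun_bound) (auto simp: bounded_linear_Blinfun_apply[OF bl] bound)
  ultimately show thesis
    by (rule that) (rule bounded_linear_Blinfun_apply[OF bl])
qed

text \<open>
  The passage from real to scalar-valued functionals. Over the complex numbers it is the formula
  \<open>F x = u x - i u (i x)\<close>, with real part \<open>u\<close>; a rotation of the argument shows that \<open>F\<close> is bounded by
  the same norm as \<open>u\<close>. The last conclusion yields \<open>F = 0\<close> on every subspace over the scalar field
  on which \<open>u\<close> vanishes.
\<close>
lemma functional_with_real_part:
  assumes u: "linear u" and bound: "\<And>x. u x \<le> norm x"
  obtains F where "F \<in> dual_space scl" and "norm F \<le> 1" and "\<And>x. \<bar>u x\<bar> \<le> norm (F x)"
    and "\<And>x. (\<And>c. u (scl c x) = 0) \<Longrightarrow> F x = 0"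
proof -
  note u_add = linear_add[OF u]
  have u_scale: "u (r *\<^sub>R x) = r * u x" for r x
    using linear_scale[OF u] by simp
  consider (real) "\<forall>z::'k. \<exists>a. z = a *\<^sub>R 1"
    | (cplx) i :: 'k where "i * i = - 1"
        "\<And>z. \<exists>a b. z = a *\<^sub>R 1 + b *\<^sub>R i \<and> norm z = sqrt (a\<^sup>2 + b\<^sup>2)"
    using real_or_complex by blast
  then show thesis
  proof cases
    case real
    have "\<bar>u x\<bar> \<le> norm x" for x
      using bound[of x] bound[of "- x"] linear_neg[OF u, of x] by (auto simp: abs_le_iff)
    moreover have "of_real (u (scl c x)) = c * of_real (u x)" for c :: 'k and x
    proof -
      obtain a where "c = of_real a"
        using real by (auto simp: scaleR_conv_of_real)
      then show ?thesis
        by (simp add: scale_of_real u_scale)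
    qed
    ultimately obtain F where F: "F \<in> dual_space scl" "norm F \<le> 1"
      "blinfun_apply F = (\<lambda>x. of_real (u x) :: 'k)"
      using dual_functionalI[of "\<lambda>x. of_real (u x)"] unfolding u_add norm_of_real of_real_add by blast
    show thesis
      using F(1,2)
    proof (rule that)
      show "F x = 0" if "\<And>c. u (scl c x) = 0" for x
        using that[of 1] by (simp add: F(3))
    qed (simp add: F(3))
  next
    case cplx
    define f where "f x = of_real (u x) - of_real (u (scl i x)) * i" for x
    have coord: "\<exists>a b. z = of_real a + of_real b * i \<and> norm z = sqrt (a\<^sup>2 + b\<^sup>2)" for z
      using cplx(2)[of z] by (simp add: scaleR_conv_of_real)
    have re: "a = u x" if "f x = of_real a + of_real b * i" for a b x
      using imaginary_unit_unique_coordinates[OF cplx(1), of a b "u x" "- u (scl i x)"] that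
      by (simp add: f_def)
    have f_add: "f (x + y) = f x + f y" for x y
      by (simp add: f_def u_add scale_right_distrib algebra_simps)
    have f_real: "f (scl (of_real r) x) = of_real r * f x" for r x
    proof -
      have "scl i (r *\<^sub>R x) = r *\<^sub>R scl i x"
        by (metis scale_left_commute scale_of_real)
      then show ?thesis
        by (simp add: f_def scale_of_real u_scale algebra_simps)
    qed
    have f_i: "f (scl i x) = i * f x" for x
    proof -
      have "scl i (scl i x) = - x"
        using cplx(1) by simp
      then have "f (scl i x) = of_real (u (scl i x)) + of_real (u x) * i"
        using linear_neg[OF u, of x] by (simp add: f_def)
      moreover have "i * f x = of_real (u x) * i - of_real (u (scl i x)) * (i * i)"
        by (simp add: f_def algebra_simps)
      ultimately show ?thesis
        unfolding cplx(1) by simp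
    qed
    have f_scale: "f (scl c x) = c * f x" for c x
    proof -
      obtain a b where c: "c = of_real a + of_real b * i"
        using coord by blast
      have "scl c x = scl (of_real a) x + scl (of_real b) (scl i x)"
        by (simp add: c scale_left_distrib)
      then have "f (scl c x) = of_real a * f x + of_real b * (i * f x)"
        by (simp only: f_add f_real f_i)
      then show ?thesis
        by (simp add: c algebra_simps)
    qed
    have f_bound: "norm (f x) \<le> norm x" for x
    proof (cases "f x = 0")
      case False
      \<comment> \<open>Rotate x so that its value becomes the real number norm (f x).\<close>
      define c where "c = of_real (norm (f x)) / f x"
      have "f (scl c x) = of_real (norm (f x)) + of_real 0 * i"
        using False by (simp add: f_scale c_def)
      then have "norm (f x) = u (scl c x)"
        by (rule re)
      also have "\<dots> \<le> norm (scl c x)"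
        by (rule bound)
      also have "\<dots> = norm x"
        using False by (simp add: norm_scale c_def norm_divide)
      finally show ?thesis .
    qed simp
    obtain F where F: "F \<in> dual_space scl" "norm F \<le> 1" "blinfun_apply F = f"
      using dual_functionalI[OF f_add f_scale f_bound] by blast
    show thesis
      using F(1,2)
    proof (rule that)
      fix x
      obtain a b where ab: "f x = of_real a + of_real b * i" "norm (f x) = sqrt (a\<^sup>2 + b\<^sup>2)"
        using coord by blast
      show "\<bar>u x\<bar> \<le> norm (F x)"
        using re[OF ab(1)] ab(2) by (simp add: F(3))
    next
      show "F x = 0" if "\<And>c. u (scl c x) = 0" for x
        using that[of 1] that[of i] by (simp add: F(3) f_def)
    qed
  qed
qed

text \<open>
  Being bounded by the distance to \<open>J\<close> encodes both requirements on a real functional \<open>u\<close>: the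
  distance is at most the norm, and it is zero on \<open>J\<close>, which forces \<open>u = 0\<close> there as \<open>J = - J\<close>.
\<close>
lemma hahn_banach_annihilator:
  assumes J: "subspace J"
  obtains F where "F \<in> annihilator scl J" and "norm F \<le> 1" and "infdist v J \<le> norm (F v)"
proof -
  have real_J: "Real_Vector_Spaces.subspace J"
    using J by (rule subspace_imp_real_subspace)
  have zero: "0 \<in> J"
    using subspace_0[OF J] .
  obtain u where u: "linear u" "u \<le> (\<lambda>x. infdist x J)" "u v = infdist v J"
    using hahn_banach_sublinear[OF sublinear_infdist[OF real_J]] .
  have u_le: "u x \<le> infdist x J" for x
    using u(2) by (simp add: le_fun_def)
  have "u x \<le> norm x" for x
    using u_le[of x] infdist_le[OF zero, of x] by simp
  then obtain F where F: "F \<in> dual_space scl" "norm F \<le> 1" "\<And>x. \<bar>u x\<bar> \<le> norm (F x)"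
    and F0: "\<And>x. (\<And>c. u (scl c x) = 0) \<Longrightarrow> F x = 0"
    using functional_with_real_part[OF u(1)] by blast
  have uJ: "u j = 0" if "j \<in> J" for j
    using u_le[of j] u_le[of "- j"] that subspace_neg[OF J that] linear_neg[OF u(1), of j] by simp
  have "F \<in> annihilator scl J"
    using F(1) by (auto simp: annihilator_def intro!: F0 uJ subspace_scale[OF J])
  then show thesis
    using F(2) F(3)[of v] u(3) infdist_nonneg[of v J] by (intro that) auto
qed

lemma dual_norming:
  obtains F where "F \<in> dual_space scl" and "norm F \<le> 1" and "norm v \<le> norm (F v)"
proof -
  have "subspace {0}"
    by (rule subspace_single_0)
  from hahn_banach_annihilator[OF this, of v] show thesis
    using that by (auto simp: annihilator_def)
qed

lemma dual_separates:
  assumes "\<And>f. f \<in> dual_space scl \<Longrightarrow> f v = f w"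
  shows "v = w"
proof -
  obtain F where "F \<in> dual_space scl" "norm (v - w) \<le> norm (F (v - w))"
    using dual_norming .
  with assms show ?thesis
    by (simp add: blinfun.diff_right)
qed

lemma closed_subspace_mem_iff_annihilated:
  assumes "subspace J" and "closed J"
  shows "v \<in> J \<longleftrightarrow> (\<forall>f\<in>annihilator scl J. f v = 0)"
proof
  assume *: "\<forall>f\<in>annihilator scl J. f v = 0"
  obtain F where "F \<in> annihilator scl J" "infdist v J \<le> norm (F v)"
    using hahn_banach_annihilator[OF assms(1)] .
  with * have "infdist v J = 0"
    using infdist_nonneg[of v J] by auto
  then show "v \<in> J"
    using in_closed_iff_infdist_zero[OF assms(2)] subspace_0[OF assms(1)] by blast
qed (auto simp: annihilator_def)

section \<open>The complementary projection of an M-ideal\<close>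

text \<open>
  \<open>Q\<close> is the preadjoint of the L-projection \<open>P\<close>: the point \<open>Q x\<close> represents the bidual element
  \<open>f \<mapsto> (P f) x\<close>. Each property of \<open>Q\<close> mirrors one of \<open>P\<close>, tested against functionals.
\<close>
lemma reflexive_M_ideal_projection:
  assumes refl: "reflexive_space scl" and M: "M_ideal scl J"
  obtains Q where "\<And>x y. Q (x + y) = Q x + Q y" and "\<And>c x. Q (scl c x) = scl c (Q x)"
    and "\<And>j. j \<in> J \<Longrightarrow> Q j = 0" and "\<And>x. x - Q x \<in> J" and "\<And>x. norm (Q x) \<le> norm x"
proof -
  from M have J: "subspace J" and clJ: "closed J"
    and L: "L_summand_of_dual scl (annihilator scl J)"
    by (auto simp: M_ideal_def)
  let ?D = "dual_space scl"
  obtain P :: "('a \<Rightarrow>\<^sub>L 'k) \<Rightarrow> ('a \<Rightarrow>\<^sub>L 'k)"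
    where P_add: "\<And>f g. f \<in> ?D \<Longrightarrow> g \<in> ?D \<Longrightarrow> P (f + g) = P f + P g"
      and P_scale: "\<And>c f. f \<in> ?D \<Longrightarrow> P (fun_scale c f) = fun_scale c (P f)"
      and P_image: "P ` ?D = annihilator scl J"
      and P_id: "\<And>f. f \<in> annihilator scl J \<Longrightarrow> P f = f"
      and P_norm: "\<And>f. f \<in> ?D \<Longrightarrow> norm f = norm (P f) + norm (f - P f)"
    using L unfolding L_summand_of_dual_def by metis
  have P_ann: "P f \<in> annihilator scl J" if "f \<in> ?D" for f
    using P_image that by blast
  then have P_lin: "P f (scl c x) = c * P f x" if "f \<in> ?D" for f c x
    using that by (auto simp: annihilator_def dual_space_def)
  have P_bound: "norm (P f x) \<le> norm f * norm x" if "f \<in> ?D" for f x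
  proof -
    have "norm (P f) \<le> norm f"
      using P_norm[OF that] by simp
    then show ?thesis
      using norm_blinfun[of "P f" x] by (meson mult_right_mono norm_ge_zero order_trans)
  qed
  have "\<exists>w. \<forall>f\<in>?D. P f x = f w" for x
  proof -
    have "bidual_element scl (\<lambda>f. P f x)"
      unfolding bidual_element_def
      using P_bound[of _ x] by (auto simp: P_add P_scale blinfun.add_left mult.commute intro!: exI[of _ "norm x"])
    then show ?thesis
      using refl unfolding reflexive_space_def by blast
  qed
  then obtain Q where Q: "\<And>f x. f \<in> ?D \<Longrightarrow> f (Q x) = P f x"
    by metis
  show thesis
  proof (rule that)
    show "Q (x + y) = Q x + Q y" for x y
      by (rule dual_separates) (simp add: Q blinfun.add_right)
    show "Q (scl c x) = scl c (Q x)" for c x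
    proof (rule dual_separates)
      fix f assume f: "f \<in> ?D"
      then have "f (scl c (Q x)) = c * f (Q x)"
        by (simp add: dual_space_def)
      then show "f (Q (scl c x)) = f (scl c (Q x))"
        using f by (simp add: Q P_lin)
    qed
    show "Q j = 0" if "j \<in> J" for j
    proof (rule dual_separates)
      fix f assume f: "f \<in> ?D"
      then show "f (Q j) = f 0"
        using P_ann[OF f] that by (simp add: Q annihilator_def)
    qed
    show "x - Q x \<in> J" for x
      unfolding closed_subspace_mem_iff_annihilated[OF J clJ]
      using P_id Q[of _ x] by (auto simp: blinfun.diff_right annihilator_def)
    show "norm (Q x) \<le> norm x" for x
    proof -
      obtain F where F: "F \<in> ?D" "norm F \<le> 1" "norm (Q x) \<le> norm (F (Q x))"
        using dual_norming .
      have "norm (Q x) \<le> norm F * norm x"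
        using F P_bound[OF F(1), of x] by (simp add: Q)
      also have "\<dots> \<le> norm x"
        using F(2) by (simp add: mult_left_le_one_le)
      finally show ?thesis .
    qed
  qed
qed

section \<open>Lifting operators through the quotient\<close>

lemma quot_map_eq_iff:
  assumes J: "subspace J"
  shows "quot_map J x = quot_map J y \<longleftrightarrow> x - y \<in> J"
proof
  assume "quot_map J x = quot_map J y"
  moreover have "x \<in> quot_map J x"
    using subspace_0[OF J] by (auto simp: quot_map_def intro: image_eqI[of _ _ 0])
  ultimately obtain j where "j \<in> J" "x = y + j"
    by (auto simp: quot_map_def)
  then show "x - y \<in> J"
    by simp
next
  assume *: "x - y \<in> J"
  have "quot_map J a \<subseteq> quot_map J b" if ab: "a - b \<in> J" for a b
  proof
    fix z assume "z \<in> quot_map J a"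
    then obtain j where j: "j \<in> J" "z = a + j"
      by (auto simp: quot_map_def)
    then have "z = b + ((a - b) + j)"
      by simp
    then show "z \<in> quot_map J b"
      unfolding quot_map_def using subspace_add[OF J ab j(1)] by blast
  qed
  then show "quot_map J x = quot_map J y"
    using * subspace_neg[OF J *] by (intro antisym) auto
qed

end

text \<open>
  The projection \<open>Q\<close> selects from each coset its element of least norm, linearly, and \<open>T\<close> is \<open>S\<close>
  followed by this selection.
\<close>
theorem proposition25:
  fixes scl :: "'k::real_or_complex \<Rightarrow> 'a::banach \<Rightarrow> 'a"
    and J :: "'a set"
  assumes "banach_space_over scl"
    and "reflexive_space scl"
    and "M_ideal scl J"
  shows "quotient_lifting_property scl J TYPE('b::banach)"
proof -
  interpret X: banach_space_over scl
    by fact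
  from assms(3) have J: "X.subspace J"
    by (simp add: M_ideal_def)
  obtain Q where Q_add: "\<And>x y. Q (x + y) = Q x + Q y"
    and Q_scale: "\<And>c x. Q (scl c x) = scl c (Q x)"
    and Q_zero: "\<And>j. j \<in> J \<Longrightarrow> Q j = 0" and Q_diff: "\<And>x. x - Q x \<in> J"
    and Q_norm: "\<And>x. norm (Q x) \<le> norm x"
    using X.reflexive_M_ideal_projection[OF assms(2,3)] by blast
  have Q_cong: "Q x = Q y" if "quot_map J x = quot_map J y" for x y
  proof -
    have "x - y \<in> J"
      using that X.quot_map_eq_iff[OF J] by blast
    then show ?thesis
      using Q_add[of "x - y" y] Q_zero by simp
  qed
  have Q_quot: "quot_map J (Q x) = quot_map J x" for x
    using Q_diff[of x] X.quot_map_eq_iff[OF J] by metis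
  have Q_isometry: "norm (Q x) = quot_norm (quot_map J x)" for x
  proof (rule antisym)
    have "norm (Q x) \<le> norm (x + j)" if "j \<in> J" for j
      using Q_norm[of "x + j"] Q_add[of x j] Q_zero[OF that] by simp
    then show "norm (Q x) \<le> quot_norm (quot_map J x)"
      unfolding quot_norm_quot_map using X.subspace_0[OF J] by (intro cINF_greatest) auto
    have "quot_norm (quot_map J (Q x)) \<le> norm (Q x + 0)"
      unfolding quot_norm_quot_map using X.subspace_0[OF J]
      by (intro cINF_lower bdd_belowI[of _ 0]) auto
    then show "quot_norm (quot_map J x) \<le> norm (Q x)"
      by (simp add: Q_quot)
  qed
  show ?thesis
    unfolding quotient_lifting_property_def
  proof (intro allI impI, elim conjE)
    fix scaleY :: "'k \<Rightarrow> 'b \<Rightarrow> 'b" and S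
    assume Y: "banach_space_over scaleY" and "bounded_linear_to_quot scaleY scl J S"
    then obtain K where S_range: "\<And>y. S y \<in> range (quot_map J)"
      and S_add: "\<And>y z. S (y + z) = S y + S z"
      and S_scale: "\<And>c y. S (scaleY c y) = quot_scale scl J c (S y)"
      and S_bound: "\<And>y. quot_norm (S y) \<le> K * norm y"
      by (auto simp: bounded_linear_to_quot_def)
    define s where "s y = (SOME x. S y = quot_map J x)" for y
    have s: "S y = quot_map J (s y)" for y
      unfolding s_def using S_range[of y] by (intro someI_ex[of "\<lambda>x. S y = quot_map J x"]) blast
    define T where "T y = Q (s y)" for y
    have T_add: "T (y + z) = T y + T z" for y z
    proof -
      have "quot_map J (s (y + z)) = quot_map J (s y + s z)"
        using S_add[of y z] by (simp add: s quot_map_add[OF assms(1) J])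
      then show ?thesis
        unfolding T_def Q_add[symmetric] by (rule Q_cong)
    qed
    have T_scale: "T (scaleY c y) = scl c (T y)" for c y
    proof -
      have "quot_map J (s (scaleY c y)) = quot_map J (scl c (s y))"
        using S_scale[of c y] by (simp add: s quot_scale_quot_map[OF assms(1) J])
      then show ?thesis
        unfolding T_def Q_scale[symmetric] by (rule Q_cong)
    qed
    have T_norm: "norm (T y) = quot_norm (S y)" for y
      by (simp add: T_def s Q_isometry)
    have bl: "bounded_linear T"
    proof (rule bounded_linear_intro[OF T_add])
      show "T (r *\<^sub>R y) = r *\<^sub>R T y" for r y
        using T_scale[of "of_real r" y]
        by (simp add: X.scale_of_real banach_space_over.scale_of_real[OF Y])
      show "norm (T y) \<le> norm y * K" for y
        using S_bound[of y] by (simp add: T_norm mult.commute)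
    qed
    have apply_T: "blinfun_apply (Blinfun T) = T"
      by (rule bounded_linear_Blinfun_apply[OF bl])
    show "\<exists>L :: 'b \<Rightarrow>\<^sub>L 'a.
        (\<forall>c y. blinfun_apply L (scaleY c y) = scl c (blinfun_apply L y)) \<and>
        quot_map J \<circ> blinfun_apply L = S \<and> norm L = quot_onorm S"
    proof (intro exI[of _ "Blinfun T"] conjI)
      show "\<forall>c y. blinfun_apply (Blinfun T) (scaleY c y) = scl c (blinfun_apply (Blinfun T) y)"
        by (simp only: apply_T T_scale simp_thms)
      show "quot_map J \<circ> blinfun_apply (Blinfun T) = S"
        by (rule ext) (simp add: apply_T T_def Q_quot s)
      have "norm (Blinfun T) = onorm T"
        by (simp add: norm_blinfun.rep_eq apply_T)
      then show "norm (Blinfun T) = quot_onorm S"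
        by (simp add: onorm_def quot_onorm_def T_norm)
    qed
  qed
qed

end
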